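(* Let $L,\gamma,\lambda_\sigma>0$ and $a_\sigma:=\lambda_\sigma/L$. Let $\mu_\sigma$ be the unique positive zero of $$p_{a_\sigma}(x)=x^3+\gamma x^2+(\gamma^2-a_\sigma)x-\gamma a_\sigma,$$ and let $\nu_{\sigma,L}$ be the positive unstable rate of the linear system $\dot q=v$, $\dot v=a_\sigma q-\gamma v$, that is, the positive number with $\nu_{\sigma,L}(\nu_{\sigma,L}+\gamma)=a_\sigma$, equivalently $\nu_{\sigma,L}=\tfrac12\big(\sqrt{\gamma^2+4a_\sigma}-\gamma\big)$. Then $$\mu_\sigma>\nu_{\sigma,L}$$ for all positive choices of $L,\gamma,\lambda_\sigma$. Consequently, the third-order Eyring--Kramers prefactor $\frac{2\pi}{\mu_\sigma}\sqrt{\frac{-\det H_\sigma}{\det H_m}}$ is strictly smaller than the prefactor $\frac{2\pi}{\nu_{\sigma,L}}\sqrt{\frac{-\det H_\sigma}{\det H_m}}$ of the underdamped Langevin diffusion with the same kinetic scaling.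
   Context: $U$ is a smooth potential on $\mathbb R^d$ with a non-degenerate local minimum $m$ (Hessian $H_m=\nabla^2U(m)$ positive definite) and an index-one saddle $\sigma$ whose Hessian $H_\sigma=\nabla^2U(\sigma)$ has exactly one negative eigenvalue $-\lambda_\sigma<0$ and $d-1$ positive eigenvalues. The third-order Langevin diffusion is $d\theta=p\,dt$, $dp=-L^{-1}\nabla U(\theta)dt+\gamma r\,dt$, $dr=-\gamma p\,dt-\gamma r\,dt+\sqrt{2\gamma\varepsilon/L}\,dB$; $\mu_\sigma$ is its unstable rate at $\sigma$. The underdamped diffusion with matched kinetic scaling is $d\theta=p\,dt$, $dp=-L^{-1}\nabla U(\theta)dt-\gamma p\,dt+\sqrt{2\gamma\varepsilon/L}\,dB$; along the unstable eigenvector of $H_\sigma$ its linearized deterministic dynamics is $\dot q=v$, $\dot v=a_\sigma q-\gamma v$. The Eyring--Kramers prefactor is the factor multiplying $\exp((U(\sigma)-U(m))/\varepsilon)$ in the low-temperature asymptotics of the mean transition time, and it has the displayed form in each of the two cases. *)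

theory Defs
  imports "HOL-Analysis.Analysis" "HOL-Computational_Algebra.Polynomial"
begin

section \<open>Spectra of real square matrices\<close>

definition charpoly :: "real^'n^'n \<Rightarrow> real poly" where
  "charpoly A = det (\<chi> i j. (if i = j then [:0, 1:] else 0) - [:A $ i $ j:])"

text \<open>Real eigenvalues, counted with algebraic multiplicity.\<close>

definition eigenvalues :: "real^'n^'n \<Rightarrow> real multiset" where
  "eigenvalues A = proots (charpoly A)"

text \<open>Symmetry is not part of the definition: it is only applied to Hessians of smooth
  functions, where it is automatic.\<close>

definition positive_definite :: "real^'n^'n \<Rightarrow> bool" where
  "positive_definite A \<longleftrightarrow> (\<forall>x. x \<noteq> 0 \<longrightarrow> 0 < x \<bullet> (A *v x))"


section \<open>Smooth potentials and their critical points\<close>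

definition partial_deriv :: "'n \<Rightarrow> (real^'n \<Rightarrow> real) \<Rightarrow> real^'n \<Rightarrow> real" where
  "partial_deriv i f = (\<lambda>x. frechet_derivative f (at x) (axis i 1))"

text \<open>All iterated partial derivatives exist and are Frechet differentiable (hence continuous)
  on the whole space, which is the class of infinitely differentiable functions.\<close>

definition smooth :: "(real^'n \<Rightarrow> real) \<Rightarrow> bool" where
  "smooth f \<longleftrightarrow> (\<forall>is. foldr partial_deriv is f differentiable_on UNIV)"

definition hessian :: "(real^'n \<Rightarrow> real) \<Rightarrow> real^'n \<Rightarrow> real^'n^'n" where
  "hessian f x = (\<chi> i j. partial_deriv i (partial_deriv j f) x)"

definition nondegenerate_local_min :: "(real^'n \<Rightarrow> real) \<Rightarrow> real^'n \<Rightarrow> bool" where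
  "nondegenerate_local_min U m \<longleftrightarrow>
     (\<exists>e>0. \<forall>x\<in>ball m e. U m \<le> U x) \<and> positive_definite (hessian U m)"

definition index_one_saddle :: "(real^'n \<Rightarrow> real) \<Rightarrow> real^'n \<Rightarrow> real \<Rightarrow> bool" where
  "index_one_saddle U \<sigma> l \<longleftrightarrow>
     (U has_derivative (\<lambda>h. 0)) (at \<sigma>) \<and>
     filter_mset (\<lambda>x. x < 0) (eigenvalues (hessian U \<sigma>)) = {# - l #} \<and>
     size (filter_mset (\<lambda>x. 0 < x) (eigenvalues (hessian U \<sigma>))) = CARD('n) - 1"


section \<open>Unstable rates and Eyring--Kramers prefactors\<close>

definition third_order_poly :: "real \<Rightarrow> real \<Rightarrow> real \<Rightarrow> real" where
  "third_order_poly \<gamma> a x = x^3 + \<gamma> * x^2 + (\<gamma>^2 - a) * x - \<gamma> * a"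

definition third_order_rate :: "real \<Rightarrow> real \<Rightarrow> real" where
  "third_order_rate \<gamma> a = (THE x. 0 < x \<and> third_order_poly \<gamma> a x = 0)"

text \<open>The unstable rate of a linear system \<open>z' = A z\<close>; meaningful when \<open>A\<close> has exactly one
  positive eigenvalue.\<close>

definition unstable_rate :: "real^'n^'n \<Rightarrow> real" where
  "unstable_rate A = (THE x. 0 < x \<and> x \<in># eigenvalues A)"

text \<open>The system \<open>q' = v\<close>, \<open>v' = a q - \<gamma> v\<close> in the coordinates \<open>(q, v)\<close>.\<close>

definition underdamped_matrix :: "real \<Rightarrow> real \<Rightarrow> real^2^2" where
  "underdamped_matrix \<gamma> a = vector [vector [0, 1], vector [a, - \<gamma>]]"

definition underdamped_rate :: "real \<Rightarrow> real \<Rightarrow> real" where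
  "underdamped_rate \<gamma> a = unstable_rate (underdamped_matrix \<gamma> a)"

definition eyring_kramers_prefactor ::
    "real \<Rightarrow> (real^'n \<Rightarrow> real) \<Rightarrow> real^'n \<Rightarrow> real^'n \<Rightarrow> real" where
  "eyring_kramers_prefactor rate U m \<sigma> =
     2 * pi / rate * sqrt (- det (hessian U \<sigma>) / det (hessian U m))"

end

theory Submission
  imports Defs
begin

text \<open>
  Write \<open>a = \<lambda>\<^sub>\<sigma> / L\<close>. The underdamped rate \<open>\<nu>\<close> satisfies \<open>a = \<nu> (\<nu> + \<gamma>)\<close>, and inserting this
  into the third-order polynomial \<open>(x + \<gamma>) (x\<^sup>2 - a) + \<gamma>\<^sup>2 x\<close> at \<open>x = \<nu>\<close> leaves \<open>- \<gamma> \<nu>\<^sup>2 < 0\<close>.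
  The polynomial is eventually positive, so it vanishes somewhere to the right of \<open>\<nu>\<close>; since it
  has only one positive zero, that zero is \<open>\<mu>\<close> and \<open>\<nu> < \<mu>\<close>.

  The two prefactors differ only in the rate, so their comparison reduces to the common factor
  \<open>sqrt (- det H\<^sub>\<sigma> / det H\<^sub>m)\<close> being strictly positive. Both determinants are read off from
  characteristic polynomials, which are monic (lemma \<open>charpoly_monic\<close>). For the minimum,
  \<open>t \<mapsto> det (t I + H\<^sub>m)\<close> is monic and has no zero on \<open>[0, \<infinity>)\<close>, hence is positive at \<open>0\<close>
  (lemma \<open>det_pos_if_positive_definite\<close>). For the saddle, the one negative and the \<open>d - 1\<close>
  positive eigenvalues exhaust the degree \<open>d\<close>, so the determinant is their product
  (lemma \<open>det_eq_prod_eigenvalues\<close>) and therefore negative.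
\<close>

section \<open>Monic characteristic polynomials\<close>

lemma prod_linear_polys:
  fixes f :: "'i \<Rightarrow> 'a::comm_ring_1 poly"
  assumes "finite S" "\<And>i. i \<in> S \<Longrightarrow> degree (f i) \<le> 1"
  shows "degree (prod f S) \<le> card S \<and> coeff (prod f S) (card S) = (\<Prod>i\<in>S. coeff (f i) 1)"
  using assms
proof (induction S rule: finite_induct)
  case empty
  then show ?case by simp
next
  case (insert i S)
  have f: "degree (f i) \<le> 1" and
    IH: "degree (prod f S) \<le> card S" "coeff (prod f S) (card S) = (\<Prod>i\<in>S. coeff (f i) 1)"
    using insert by auto
  have "degree (f i * prod f S) \<le> 1 + card S"
    using degree_mult_le[of "f i" "prod f S"] f IH(1) by linarith
  moreover have "coeff (f i * prod f S) (1 + card S) = coeff (f i) 1 * coeff (prod f S) (card S)"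
  proof -
    have "f i = [:coeff (f i) 0, coeff (f i) 1:]"
      using f by (intro poly_eqI) (auto simp: coeff_pCons coeff_eq_0 split: nat.split)
    then have "f i * prod f S
        = smult (coeff (f i) 0) (prod f S) + pCons 0 (smult (coeff (f i) 1) (prod f S))"
      by (metis mult_pCons_left mult_zero_left add_0_right pCons_0_0)
    then show ?thesis
      using IH(1) by (simp add: coeff_eq_0)
  qed
  ultimately show ?case
    using insert.hyps IH(2) by simp
qed

lemma poly_charpoly: "poly (charpoly A) x = det (mat x - A)"
  unfolding charpoly_def det_def mat_def
  by (auto simp: poly_sum poly_prod intro!: sum.cong prod.cong)

text \<open>Reading off the coefficient of degree \<open>n\<close> in the Leibniz formula leaves the Leibniz formula
  for the determinant of the identity matrix.\<close>

lemma charpoly_monic: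
  fixes A :: "real^'n^'n"
  shows "degree (charpoly A) = CARD('n)" and "lead_coeff (charpoly A) = 1"
proof -
  define f where
    "f p i = (if i = p i then [:0, 1:] else 0) - [:A $ i $ p i:]" for p :: "'n \<Rightarrow> 'n" and i
  have char: "charpoly A
      = (\<Sum>p | p permutes UNIV. smult (of_int (sign p)) (\<Prod>i\<in>UNIV. f p i))"
    by (auto simp: charpoly_def det_def f_def of_int_poly intro!: sum.cong)
  have "degree (f p i) \<le> 1" for p i
    by (simp add: f_def)
  then have lin: "degree (\<Prod>i\<in>UNIV. f p i) \<le> CARD('n)"
      "coeff (\<Prod>i\<in>UNIV. f p i) CARD('n) = (\<Prod>i\<in>UNIV. if i = p i then 1 else 0)" for p
    using prod_linear_polys[of UNIV "f p"] by (auto simp: f_def if_distrib intro!: prod.cong)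
  have le: "degree (charpoly A) \<le> CARD('n)"
    unfolding char using lin(1) by (intro degree_sum_le) (auto intro: order_trans[OF degree_smult_le])
  have "coeff (charpoly A) CARD('n) = det (mat 1 :: real^'n^'n)"
    unfolding char det_def mat_def by (simp add: coeff_sum lin(2))
  then have coeff: "coeff (charpoly A) CARD('n) = 1"
    by simp
  show "degree (charpoly A) = CARD('n)"
    using le coeff by (metis le_antisym le_degree zero_neq_one)
  then show "lead_coeff (charpoly A) = 1"
    using coeff by simp
qed

lemma mem_eigenvalues_iff: "x \<in># eigenvalues A \<longleftrightarrow> det (mat x - A) = 0"
proof -
  have "charpoly A \<noteq> 0"
    using charpoly_monic(2)[of A] by force
  then show ?thesis
    by (simp add: eigenvalues_def poly_charpoly)
qed

section \<open>Signs of the Hessian determinants\<close>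

lemma split_poly_eq_prod_roots:
  fixes p :: "'a::idom poly"
  assumes "size (proots p) = degree p"
  shows "p = smult (lead_coeff p) (\<Prod>x\<in>#proots p. [:- x, 1:])"
  using assms
proof (induction p rule: poly_root_order_induct)
  case (no_roots p)
  then have "proots p = {#}"
    by (simp add: multiset_eqI order_root)
  then show ?case
    using no_roots by (auto elim: degree_eq_zeroE)
next
  case (root p x n)
  have [simp]: "p \<noteq> 0"
    using root.hyps by auto
  have roots: "proots ([:- x, 1:] ^ n * p) = repeat_mset n {#x#} + proots p"
    by (simp add: proots_mult proots_power)
  have "size (proots p) = degree p"
    using root.prems unfolding roots by (simp add: degree_mult_eq degree_power_eq)
  from root.IH[OF this] have "p = smult (lead_coeff p) (\<Prod>x\<in>#proots p. [:- x, 1:])" .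
  then show ?case
    unfolding roots by (simp add: lead_coeff_mult lead_coeff_power flip: mult_smult_right)
qed auto

lemma det_uminus:
  fixes A :: "'a::comm_ring_1^'n^'n"
  shows "det (- A) = (- 1) ^ CARD('n) * det A"
  by (simp add: det_def prod_uminus sum_distrib_left mult_ac)

lemma det_eq_prod_eigenvalues:
  fixes A :: "real^'n^'n"
  assumes "size (eigenvalues A) = CARD('n)"
  shows "det A = prod_mset (eigenvalues A)"
proof -
  have neg: "(\<Prod>x\<in>#M. - x) = (- 1) ^ size M * prod_mset M" for M :: "real multiset"
    by (induction M) auto
  have "charpoly A = (\<Prod>x\<in>#eigenvalues A. [:- x, 1:])"
    using split_poly_eq_prod_roots[of "charpoly A"] assms charpoly_monic[of A]
    by (simp add: eigenvalues_def)
  then have "poly (charpoly A) 0 = (- 1) ^ CARD('n) * prod_mset (eigenvalues A)"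
    using neg[of "eigenvalues A"] by (simp add: poly_prod_mset assms)
  moreover have "poly (charpoly A) 0 = (- 1) ^ CARD('n) * det A"
    using det_uminus[of A] by (simp add: poly_charpoly mat_def zero_vec_def[symmetric])
  ultimately show ?thesis
    by simp
qed

lemma det_neg_if_one_negative_eigenvalue:
  fixes A :: "real^'n^'n"
  assumes neg: "filter_mset (\<lambda>x. x < 0) (eigenvalues A) = {#- l#}" and "0 < l"
    and pos: "size (filter_mset (\<lambda>x. 0 < x) (eigenvalues A)) = CARD('n) - 1"
  shows "det A < 0"
proof -
  define E P where "E = eigenvalues A" and "P = filter_mset (\<lambda>x. 0 < x) E"
  define Z where "Z = filter_mset (\<lambda>x. x = 0) E"
  have split: "E = add_mset (- l) P + Z"
  proof -
    have "E = filter_mset (\<lambda>x. x < 0) E + P + Z"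
      unfolding P_def Z_def by (intro multiset_eqI) auto
    then show ?thesis
      using neg by (simp add: E_def)
  qed
  have "size E \<le> CARD('n)"
    unfolding E_def eigenvalues_def using size_proots_le charpoly_monic(1) by metis
  moreover have "size P = CARD('n) - 1"
    using pos by (simp add: P_def E_def)
  moreover have "0 < CARD('n)"
    by simp
  \<comment> \<open>The eigenvalues of nonzero sign already fill the degree, which leaves no room for \<open>0\<close>.\<close>
  ultimately have "size Z = 0" and card: "size E = CARD('n)"
    using arg_cong[OF split, of size] by (auto simp del: zero_less_card_finite)
  then have E: "E = add_mset (- l) P"
    using split by simp
  have "0 < prod_mset M" if "\<And>x. x \<in># M \<Longrightarrow> 0 < x" for M :: "real multiset"
    using that by (induction M) auto
  from this[of P] have "0 < prod_mset P"
    by (simp add: P_def)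
  moreover have "det A = - l * prod_mset P"
    using det_eq_prod_eigenvalues[of A] card E by (simp add: E_def)
  ultimately show ?thesis
    using \<open>0 < l\<close> by (simp add: mult_pos_pos)
qed

lemma monic_pos_if_no_root_above:
  fixes p :: "real poly"
  assumes "lead_coeff p = 1" and "\<And>t. x \<le> t \<Longrightarrow> poly p t \<noteq> 0"
  shows "0 < poly p x"
proof (rule ccontr)
  assume "\<not> 0 < poly p x"
  then have neg: "poly p x < 0"
    using assms(2)[of x] by force
  obtain n where n: "\<And>t. n \<le> t \<Longrightarrow> 1 \<le> poly p t"
    using poly_pinfty_gt_lc[of p] assms(1) by auto
  have "x < max n (x + 1)" and "0 < poly p (max n (x + 1))"
    using n[of "max n (x + 1)"] by auto
  from poly_IVT_pos[OF this(1) neg this(2)] show False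
    using assms(2) by force
qed

lemma det_pos_if_positive_definite:
  fixes A :: "real^'n^'n"
  assumes "positive_definite A"
  shows "0 < det A"
proof -
  have "det (mat t + A) \<noteq> 0" if "0 \<le> t" for t
  proof
    assume "det (mat t + A) = 0"
    then obtain x where "x \<noteq> 0" and ker: "(mat t + A) *v x = 0"
      by (metis invertible_det_nz invertible_left_inverse matrix_left_invertible_ker)
    have "mat t *v x = t *\<^sub>R x"
      by (simp add: matrix_vector_mult_def mat_def vec_eq_iff if_distrib if_distribR sum.delta cong: if_cong)
    then have "t * (x \<bullet> x) + x \<bullet> (A *v x) = x \<bullet> ((mat t + A) *v x)"
      by (simp add: matrix_vector_mult_add_rdistrib inner_add_right)
    also have "\<dots> = 0"
      by (simp add: ker)
    finally have "t * (x \<bullet> x) + x \<bullet> (A *v x) = 0" .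
    moreover have "0 < x \<bullet> (A *v x)"
      using assms \<open>x \<noteq> 0\<close> by (simp add: positive_definite_def)
    moreover have "0 \<le> t * (x \<bullet> x)"
      using that by simp
    ultimately show False
      by linarith
  qed
  then have "0 < poly (charpoly (- A)) 0"
    by (intro monic_pos_if_no_root_above) (auto simp: charpoly_monic(2) poly_charpoly)
  then show ?thesis
    by (simp add: poly_charpoly mat_def zero_vec_def[symmetric])
qed

lemma eyring_kramers_prefactor_strict_antimono:
  assumes "0 < \<nu>" "\<nu> < \<mu>" "0 < lam"
    and "nondegenerate_local_min U m" "index_one_saddle U \<sigma> lam"
  shows "eyring_kramers_prefactor \<mu> U m \<sigma> < eyring_kramers_prefactor \<nu> U m \<sigma>"
proof -
  have "0 < det (hessian U m)"
    using assms by (simp add: nondegenerate_local_min_def det_pos_if_positive_definite)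
  moreover have "det (hessian U \<sigma>) < 0"
    using assms by (auto simp: index_one_saddle_def intro: det_neg_if_one_negative_eigenvalue)
  ultimately have "0 < sqrt (- det (hessian U \<sigma>) / det (hessian U m))"
    by (simp add: divide_neg_pos)
  moreover have "2 * pi / \<mu> < 2 * pi / \<nu>"
    using assms by (intro divide_strict_left_mono mult_pos_pos) auto
  ultimately show ?thesis
    unfolding eyring_kramers_prefactor_def by (rule mult_strict_right_mono[rotated])
qed

section \<open>The two unstable rates\<close>

lemma mem_eigenvalues_underdamped_iff:
  "x \<in># eigenvalues (underdamped_matrix \<gamma> a) \<longleftrightarrow> x * (x + \<gamma>) = a"
  by (auto simp: mem_eigenvalues_iff det_2 underdamped_matrix_def mat_def algebra_simps)

lemma quadratic_positive_root:
  fixes \<gamma> a x :: real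
  assumes "0 < \<gamma>" "0 < a" "0 < x"
  shows "x * (x + \<gamma>) = a \<longleftrightarrow> x = (sqrt (\<gamma>^2 + 4 * a) - \<gamma>) / 2"
proof -
  have "x * (x + \<gamma>) = a \<longleftrightarrow> (2 * x + \<gamma>)^2 = \<gamma>^2 + 4 * a"
    by (auto simp: power2_eq_square algebra_simps)
  also have "\<dots> \<longleftrightarrow> 2 * x + \<gamma> = sqrt (\<gamma>^2 + 4 * a)"
    using assms by (metis add_nonneg_nonneg less_imp_le mult_nonneg_nonneg real_sqrt_pow2
        real_sqrt_unique zero_le_numeral zero_le_power2)
  finally show ?thesis
    by auto
qed

lemma quadratic_positive_root_pos:
  fixes \<gamma> a :: real
  assumes "0 < a"
  shows "0 < (sqrt (\<gamma>^2 + 4 * a) - \<gamma>) / 2"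
  using assms real_less_rsqrt[of \<gamma> "\<gamma>^2 + 4 * a"] by simp

text \<open>On the positive axis the polynomial has the same zeros as \<open>x\<^sup>2 + \<gamma> x + \<gamma>\<^sup>2 - a - \<gamma> a / x\<close>,
  which is strictly increasing; the cross-multiplied difference of its values at two zeros
  factors.\<close>

lemma third_order_poly_positive_root_unique:
  assumes "0 < \<gamma>" "0 < a" "0 < x" "0 < y"
    and "third_order_poly \<gamma> a x = 0" "third_order_poly \<gamma> a y = 0"
  shows "x = y"
proof -
  have "(x - y) * (x * y * (x + y) + \<gamma> * x * y + \<gamma> * a)
      = y * third_order_poly \<gamma> a x - x * third_order_poly \<gamma> a y"
    by (simp add: third_order_poly_def power2_eq_square power3_eq_cube algebra_simps)
  also have "\<dots> = 0"
    using assms by simp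
  finally have "x - y = 0 \<or> x * y * (x + y) + \<gamma> * x * y + \<gamma> * a = 0"
    by simp
  moreover have "0 < x * y * (x + y) + \<gamma> * x * y + \<gamma> * a"
    using assms by (intro add_pos_pos mult_pos_pos) auto
  ultimately show ?thesis
    by auto
qed

lemma third_order_poly_root_above:
  assumes "0 < \<gamma>" "0 < a" "0 < \<nu>" "\<nu> * (\<nu> + \<gamma>) = a"
  shows "\<exists>x>\<nu>. third_order_poly \<gamma> a x = 0"
proof -
  define p where "p = [:- (\<gamma> * a), \<gamma>^2 - a, \<gamma>, 1:]"
  have p: "poly p x = third_order_poly \<gamma> a x" for x
    by (simp add: p_def third_order_poly_def power2_eq_square power3_eq_cube algebra_simps)
  have "third_order_poly \<gamma> a \<nu> = - \<gamma> * \<nu>^2"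
    unfolding third_order_poly_def assms(4)[symmetric]
    by (simp add: power2_eq_square power3_eq_cube algebra_simps)
  then have "poly p \<nu> < 0"
    using assms by (simp add: p)
  then obtain x where "\<nu> \<le> x" "poly p x = 0"
    using monic_pos_if_no_root_above[of p \<nu>] by (force simp: p_def)
  with \<open>poly p \<nu> < 0\<close> show ?thesis
    by (metis p le_less less_irrefl)
qed

theorem mainTheorem2:
  fixes L \<gamma> lam a \<mu> \<nu> :: real
  assumes "0 < L" and "0 < \<gamma>" and "0 < lam"
    and "a = lam / L"
    and "\<mu> = third_order_rate \<gamma> a"
    and "\<nu> = underdamped_rate \<gamma> a"
  shows "(\<exists>!x. 0 < x \<and> third_order_poly \<gamma> a x = 0) \<and>
         0 < \<mu> \<and> third_order_poly \<gamma> a \<mu> = 0 \<and>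
         (\<exists>!x. 0 < x \<and> x \<in># eigenvalues (underdamped_matrix \<gamma> a)) \<and>
         0 < \<nu> \<and> \<nu> \<in># eigenvalues (underdamped_matrix \<gamma> a) \<and>
         (\<forall>x>0. x * (x + \<gamma>) = a \<longleftrightarrow> x = \<nu>) \<and>
         \<nu> = (sqrt (\<gamma>^2 + 4 * a) - \<gamma>) / 2 \<and>
         \<nu> < \<mu> \<and>
         (\<forall>(U :: real^'d \<Rightarrow> real) m \<sigma>.
            smooth U \<and> nondegenerate_local_min U m \<and> index_one_saddle U \<sigma> lam \<longrightarrow>
            eyring_kramers_prefactor \<mu> U m \<sigma> < eyring_kramers_prefactor \<nu> U m \<sigma>)"
proof -
  have "0 < a"
    using assms by simp
  define s where "s = (sqrt (\<gamma>^2 + 4 * a) - \<gamma>) / 2"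
  have "0 < s"
    using quadratic_positive_root_pos[OF \<open>0 < a\<close>] by (simp add: s_def)
  have quad: "x * (x + \<gamma>) = a \<longleftrightarrow> x = s" if "0 < x" for x
    using quadratic_positive_root[OF \<open>0 < \<gamma>\<close> \<open>0 < a\<close> that] by (simp add: s_def)
  have eig: "0 < x \<and> x \<in># eigenvalues (underdamped_matrix \<gamma> a) \<longleftrightarrow> x = s" for x
    using quad \<open>0 < s\<close> by (auto simp: mem_eigenvalues_underdamped_iff)
  then have "\<nu> = s"
    unfolding assms(6) underdamped_rate_def unstable_rate_def by simp
  obtain r where "s < r" and root: "third_order_poly \<gamma> a r = 0"
    using third_order_poly_root_above[OF \<open>0 < \<gamma>\<close> \<open>0 < a\<close> \<open>0 < s\<close>] quad \<open>0 < s\<close> by blast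
  have "0 < r"
    using \<open>0 < s\<close> \<open>s < r\<close> by simp
  have cubic: "0 < x \<and> third_order_poly \<gamma> a x = 0 \<longleftrightarrow> x = r" for x
    using third_order_poly_positive_root_unique[OF \<open>0 < \<gamma>\<close> \<open>0 < a\<close>] root \<open>0 < r\<close> by blast
  then have "\<mu> = r"
    unfolding assms(5) third_order_rate_def by simp
  have "\<nu> < \<mu>"
    using \<open>\<nu> = s\<close> \<open>\<mu> = r\<close> \<open>s < r\<close> by simp
  have "\<forall>(U :: real^'d \<Rightarrow> real) m \<sigma>.
      smooth U \<and> nondegenerate_local_min U m \<and> index_one_saddle U \<sigma> lam \<longrightarrow>
      eyring_kramers_prefactor \<mu> U m \<sigma> < eyring_kramers_prefactor \<nu> U m \<sigma>"
    using eyring_kramers_prefactor_strict_antimono[OF _ \<open>\<nu> < \<mu>\<close> \<open>0 < lam\<close>] \<open>0 < s\<close> \<open>\<nu> = s\<close>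
    by blast
  moreover have "\<exists>!x. 0 < x \<and> third_order_poly \<gamma> a x = 0"
    unfolding cubic by simp
  moreover have "\<exists>!x. 0 < x \<and> x \<in># eigenvalues (underdamped_matrix \<gamma> a)"
    unfolding eig by simp
  moreover have "0 < \<mu>" "third_order_poly \<gamma> a \<mu> = 0"
    using cubic[of \<mu>] \<open>\<mu> = r\<close> by simp_all
  moreover have "0 < \<nu>" "\<nu> \<in># eigenvalues (underdamped_matrix \<gamma> a)"
    using eig[of \<nu>] \<open>\<nu> = s\<close> by simp_all
  moreover have "\<forall>x>0. x * (x + \<gamma>) = a \<longleftrightarrow> x = \<nu>"
    using quad \<open>\<nu> = s\<close> by simp
  moreover have "\<nu> = (sqrt (\<gamma>^2 + 4 * a) - \<gamma>) / 2"
    using \<open>\<nu> = s\<close> by (simp add: s_def)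
  ultimately show ?thesis
    using \<open>\<nu> < \<mu>\<close> by (intro conjI) assumption+
qed

end
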